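(* Let $n\ge 2$, $r>n-1$, and let $\tilde b\in\mathbb{R}^n$ be a constant vector satisfying the Diophantine condition: there is a constant $c>0$ such that $|\tilde b\cdot k|\ge c|k|^{-r}$ for all $k\in\mathbb{Z}^n\setminus\{0\}$. Let $m\ge 0$ and let $(U_0,B_0)\in H^m(\mathbb{T}^n)$ satisfy $$\int_{\mathbb{T}^n}U_0\,dx=0,\qquad \int_{\mathbb{T}^n}B_0\,dx=0.$$ Let $(U,B)$ be the corresponding solution of the linear system $$\begin{cases}\partial_t U-\Delta U=\tilde b\cdot\nabla B,\\ \partial_t B=\tilde b\cdot\nabla U,\\ \nabla\cdot U=\nabla\cdot B=0,\\ U(x,0)=U_0(x),\quad B(x,0)=B_0(x),\end{cases}$$ on $\mathbb{T}^n\times[0,\infty)$. Then for any $s\in[0,m]$ there is a constant $C>0$, independent of $t$ and of the initial data, such that for all $t\ge 0$ $$\|U(t)\|_{H^s}\le C(1+t)^{-\left(\frac12+\frac{m-s+1}{2(1+r)}\right)}\|(U_0,B_0)\|_{H^m},$$ $$\|B(t)\|_{H^s}\le C(1+t)^{-\frac{m-s}{2(1+r)}}\|(U_0,B_0)\|_{H^m}.$$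
   Context: $\mathbb{T}^n=[0,2\pi]^n$ with periodic boundary conditions; Fourier frequencies are $k\in\mathbb{Z}^n$. $U,B:\mathbb{T}^n\times[0,\infty)\to\mathbb{R}^n$ are vector fields; the system includes the divergence-free constraint, so $U_0,B_0$ are divergence free. $H^s=H^s(\mathbb{T}^n)$ is the usual $L^2$-based Sobolev space, and $\|(U_0,B_0)\|_{H^m}$ is the norm of the pair. *)

theory Defs
  imports "HOL-Analysis.Analysis"
begin

text \<open>
  Functions on the torus are functions on all of \<open>\<real>\<^sup>n\<close> that are \<open>2\<pi>\<close>-periodic in each coordinate;
  integrals are taken over one period cell.
\<close>

definition torus :: "(real ^ 'n) set" where
  "torus = cbox 0 (\<chi> i. 2 * pi)"

definition torus_periodic :: "(real ^ 'n \<Rightarrow> 'a) \<Rightarrow> bool" where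
  "torus_periodic f \<longleftrightarrow> (\<forall>x i. f (x + axis i (2 * pi)) = f x)"

definition L2_torus :: "(real ^ 'n \<Rightarrow> real ^ 'n) set" where
  "L2_torus = {f. torus_periodic f \<and> f \<in> borel_measurable (lebesgue_on torus)
                  \<and> integrable (lebesgue_on torus) (\<lambda>x. (norm (f x))\<^sup>2)}"

definition freq :: "int ^ 'n \<Rightarrow> real ^ 'n" where
  "freq k = (\<chi> i. real_of_int (k $ i))"

definition fourier_coeff :: "(real ^ 'n \<Rightarrow> real ^ 'n) \<Rightarrow> int ^ 'n \<Rightarrow> complex ^ 'n" where
  "fourier_coeff f k =
     (\<chi> j. (LINT x|lebesgue_on torus. exp (- \<i> * of_real (freq k \<bullet> x)) * of_real (f x $ j))
            / of_real ((2 * pi) ^ CARD('n)))"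

text \<open>Meant for \<open>s \<ge> 0\<close>, where \<open>H\<^sup>s\<close> is contained in \<open>L\<^sup>2\<close>.\<close>

definition sobolev :: "real \<Rightarrow> (real ^ 'n \<Rightarrow> real ^ 'n) set" where
  "sobolev s = {f \<in> L2_torus.
     (\<lambda>k. (1 + (norm (freq k))\<^sup>2) powr s * (norm (fourier_coeff f k))\<^sup>2) summable_on UNIV}"

text \<open>
  The norm is meaningful only on \<open>sobolev s\<close>: a divergent series has \<open>infsum\<close> zero. With this
  normalisation the \<open>H\<^sup>0\<close> norm is the \<open>L\<^sup>2\<close> norm for the normalised measure on the torus.
\<close>

definition sobolev_norm :: "real \<Rightarrow> (real ^ 'n \<Rightarrow> real ^ 'n) \<Rightarrow> real" where
  "sobolev_norm s f =
     sqrt (\<Sum>\<^sub>\<infinity>k. (1 + (norm (freq k))\<^sup>2) powr s * (norm (fourier_coeff f k))\<^sup>2)"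

definition sobolev_pair_norm ::
    "real \<Rightarrow> (real ^ 'n \<Rightarrow> real ^ 'n) \<Rightarrow> (real ^ 'n \<Rightarrow> real ^ 'n) \<Rightarrow> real" where
  "sobolev_pair_norm s f g = sqrt ((sobolev_norm s f)\<^sup>2 + (sobolev_norm s g)\<^sup>2)"

definition pd :: "'n \<Rightarrow> (real ^ 'n \<Rightarrow> real) \<Rightarrow> real ^ 'n \<Rightarrow> real" where
  "pd i f x = frechet_derivative f (at x) (axis i 1)"

definition grad :: "(real ^ 'n \<Rightarrow> real) \<Rightarrow> real ^ 'n \<Rightarrow> real ^ 'n" where
  "grad f x = (\<chi> i. pd i f x)"

definition laplacian :: "(real ^ 'n \<Rightarrow> real) \<Rightarrow> real ^ 'n \<Rightarrow> real" where
  "laplacian f x = (\<Sum>i\<in>UNIV. pd i (pd i f) x)"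

primrec Ck :: "nat \<Rightarrow> (real ^ 'n \<Rightarrow> real) \<Rightarrow> bool" where
  "Ck 0 f \<longleftrightarrow> continuous_on UNIV f"
| "Ck (Suc k) f \<longleftrightarrow> (\<forall>x. f differentiable (at x)) \<and> (\<forall>i. Ck k (pd i f))"

definition test_function :: "(real ^ 'n \<Rightarrow> real) \<Rightarrow> bool" where
  "test_function \<phi> \<longleftrightarrow> torus_periodic \<phi> \<and> (\<forall>k. Ck k \<phi>)"

definition div_free :: "(real ^ 'n \<Rightarrow> real ^ 'n) \<Rightarrow> bool" where
  "div_free f \<longleftrightarrow>
     (\<forall>\<phi>. test_function \<phi> \<longrightarrow> (LINT x|lebesgue_on torus. f x \<bullet> grad \<phi> x) = 0)"

text \<open>
  For initial data in \<open>H\<^sup>m\<close> with \<open>m\<close> small there is no classical solution, so the system is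
  read in the sense of distributions in space, for every time \<open>t \<ge> 0\<close>: all space derivatives are
  moved onto the test function, and the vector equations are tested componentwise (the integrals
  below are vector valued). The sign of the \<open>b \<bullet> grad \<phi>\<close> terms comes from the integration by parts.
  Distributional solutions in \<open>C([0,\<infinity>); L\<^sup>2)\<close> satisfy this definition. Conversely, testing with
  trigonometric functions shows that \<open>U t\<close> and \<open>B t\<close> are determined almost everywhere by the data.
\<close>

definition linear_MHD_solution ::
    "real ^ 'n \<Rightarrow> (real ^ 'n \<Rightarrow> real ^ 'n) \<Rightarrow> (real ^ 'n \<Rightarrow> real ^ 'n) \<Rightarrow>
     (real \<Rightarrow> real ^ 'n \<Rightarrow> real ^ 'n) \<Rightarrow> (real \<Rightarrow> real ^ 'n \<Rightarrow> real ^ 'n) \<Rightarrow> bool" where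
  "linear_MHD_solution b U\<^sub>0 B\<^sub>0 U B \<longleftrightarrow>
     (\<forall>t\<ge>0. U t \<in> L2_torus \<and> B t \<in> L2_torus) \<and>
     (\<forall>\<phi>. test_function \<phi> \<longrightarrow> (\<forall>t\<ge>0.
        ((\<lambda>\<tau>. LINT x|lebesgue_on torus. \<phi> x *\<^sub>R U \<tau> x) has_vector_derivative
           (LINT x|lebesgue_on torus. laplacian \<phi> x *\<^sub>R U t x - (b \<bullet> grad \<phi> x) *\<^sub>R B t x))
          (at t within {0..}))) \<and>
     (\<forall>\<phi>. test_function \<phi> \<longrightarrow> (\<forall>t\<ge>0.
        ((\<lambda>\<tau>. LINT x|lebesgue_on torus. \<phi> x *\<^sub>R B \<tau> x) has_vector_derivative
           (LINT x|lebesgue_on torus. - (b \<bullet> grad \<phi> x) *\<^sub>R U t x))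
          (at t within {0..}))) \<and>
     (\<forall>t\<ge>0. div_free (U t) \<and> div_free (B t)) \<and>
     (AE x in lebesgue_on torus. U 0 x = U\<^sub>0 x \<and> B 0 x = B\<^sub>0 x)"

definition diophantine :: "real \<Rightarrow> real ^ 'n \<Rightarrow> bool" where
  "diophantine r b \<longleftrightarrow>
     (\<exists>c>0. \<forall>k::int ^ 'n. k \<noteq> 0 \<longrightarrow> \<bar>b \<bullet> freq k\<bar> \<ge> c * norm (freq k) powr (- r))"

end

theory Submission
  imports Defs
begin

text \<open>
  Testing the equations with \<open>cos (k \<bullet> x)\<close> and \<open>sin (k \<bullet> x)\<close> decouples the system: for every
  frequency \<open>k\<close>, the cosine mode \<open>u\<close> of \<open>U\<close> and the sine mode \<open>v\<close> of \<open>B\<close> satisfy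
  \<open>u' = - K u + \<theta> v\<close>, \<open>v' = - \<theta> u\<close> with \<open>K = \<bar>k\<bar>\<^sup>2\<close> and \<open>\<theta> = b \<bullet> k\<close>; the other two modes satisfy the
  same system with \<open>- \<theta>\<close>. Only \<open>u\<close> is damped, but the Lyapunov function
  \<open>\<bar>u\<bar>\<^sup>2 + \<bar>v\<bar>\<^sup>2 - 2 (\<epsilon> \<theta> / K) u \<bullet> v\<close> turns the coupling into dissipation of \<open>v\<close>, and the energy decays at
  the rate \<open>\<sigma> \<sim> \<theta>\<^sup>2 / K\<close>, uniformly in \<open>k\<close>, because \<open>\<theta>\<^sup>2 \<le> \<bar>b\<bar>\<^sup>2 K\<close>. Inserting this in the equation of \<open>u\<close>
  gains the factor \<open>\<theta>\<^sup>2 / K\<^sup>2\<close>, up to a part that decays like \<open>exp (- K t)\<close>. The Diophantine condition gives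
  \<open>\<sigma> \<ge> const K powr - (1 + r)\<close>, so decay in time is bought with the weight \<open>(1 + K) powr (m - s)\<close>.
  The mode \<open>k = 0\<close> is constant in time and vanishes because the data have mean zero.
\<close>

section \<open>Exponential decay of one damped pair\<close>

lemma differential_decay:
  fixes f :: "real \<Rightarrow> real"
  assumes der: "\<And>t. t \<ge> 0 \<Longrightarrow> (f has_real_derivative f' t) (at t within {0..})"
    and le: "\<And>t. t \<ge> 0 \<Longrightarrow> f' t \<le> - a * f t"
    and t: "t \<ge> 0"
  shows "f t \<le> exp (- a * t) * f 0"
proof -
  \<comment> \<open>The integrating factor makes \<open>g\<close> nonincreasing, by the mean value
    theorem. Neither \<open>f\<close> nor \<open>a\<close> carries a sign condition;
    \<open>velocity_decay\<close> applies this to a function that may be negative.\<close>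
  define g where "g = (\<lambda>t. exp (a * t) * f t)"
  have dg: "(g has_real_derivative (exp (a * t) * (a * f t + f' t))) (at t within {0..t0})"
    if "t \<ge> 0" for t t0
  proof -
    have "(f has_real_derivative f' t) (at t within {0..t0})"
      by (rule DERIV_subset[OF der[OF that]]) auto
    then show ?thesis
      unfolding g_def by (auto intro!: derivative_eq_intros simp: algebra_simps)
  qed
  have "g t \<le> g 0"
  proof (cases "t = 0")
    case False
    with t have "0 < t" by simp
    from mvt_simple[OF this, of g "\<lambda>x y. (exp (a * x) * (a * f x + f' x)) * y"]
    obtain x where x: "x \<in> {0<..<t}" "g t - g 0 = (exp (a * x) * (a * f x + f' x)) * (t - 0)"
      using dg by (force simp: has_field_derivative_def)
    have "a * f x + f' x \<le> 0" using le[of x] x by auto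
    then have "(exp (a * x) * (a * f x + f' x)) * (t - 0) \<le> 0"
      using x by (intro mult_nonpos_nonneg mult_nonneg_nonpos) auto
    with x show ?thesis by simp
  qed simp
  then have "exp (a * t) * f t \<le> f 0" by (simp add: g_def)
  then show ?thesis by (simp add: exp_minus field_simps)
qed

text \<open>The equations of one Fourier mode. The values are vectors because all components of a
  mode share the same \<open>K\<close> and \<open>\<theta>\<close>.\<close>

locale damped_pair =
  fixes u v :: "real \<Rightarrow> 'a::real_inner" and K \<theta> :: real
  assumes u_derivative:
      "t \<ge> 0 \<Longrightarrow> (u has_vector_derivative - K *\<^sub>R u t + \<theta> *\<^sub>R v t) (at t within {0..})"
    and v_derivative: "t \<ge> 0 \<Longrightarrow> (v has_vector_derivative - \<theta> *\<^sub>R u t) (at t within {0..})"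
begin

text \<open>The three scalar products are closed under differentiation, so the estimates below
  concern real functions of time only.\<close>

lemma inner_derivatives:
  assumes "t \<ge> 0"
  shows "((\<lambda>t. u t \<bullet> u t) has_real_derivative - 2 * K * (u t \<bullet> u t) + 2 * \<theta> * (u t \<bullet> v t))
           (at t within {0..})"
    and "((\<lambda>t. v t \<bullet> v t) has_real_derivative - 2 * \<theta> * (u t \<bullet> v t)) (at t within {0..})"
    and "((\<lambda>t. u t \<bullet> v t) has_real_derivative
           - K * (u t \<bullet> v t) + \<theta> * (v t \<bullet> v t) - \<theta> * (u t \<bullet> u t)) (at t within {0..})"
  using u_derivative[OF assms] v_derivative[OF assms]
  unfolding has_vector_derivative_def has_field_derivative_def
  by (auto intro!: derivative_eq_intros
      simp: fun_eq_iff algebra_simps inner_add_left inner_add_right inner_commute)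

text \<open>Here \<open>\<beta>\<close> stands for \<open>b \<bullet> b\<close>, and
  \<open>K \<ge> 1\<close> reflects that \<open>k\<close> is a nonzero integer vector. The
  conditions on \<open>\<epsilon>\<close> involve \<open>\<beta>\<close> alone, which makes the
  constants uniform in the frequency.\<close>

context
  fixes \<beta> \<epsilon> :: real
  assumes K: "K \<ge> 1" and \<theta>: "\<theta>\<^sup>2 \<le> \<beta> * K"
    and \<epsilon>: "0 < \<epsilon>" "\<epsilon> \<le> 1 / 4" "4 * \<epsilon> * \<beta> \<le> 1"
begin

lemma rate_le: "\<epsilon> * \<theta>\<^sup>2 / K \<le> 1 / 4"
proof -
  have "\<epsilon> * \<theta>\<^sup>2 \<le> \<epsilon> * (\<beta> * K)" using \<theta> \<epsilon> by simp
  also have "\<dots> \<le> K / 4" using \<epsilon>(3) K mult_right_mono[of "4 * \<epsilon> * \<beta>" 1 K] by simp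
  finally show ?thesis using K by (simp add: field_simps)
qed

text \<open>Makes the Lyapunov function equivalent to the energy. The square of
  \<open>\<epsilon> * \<theta> / K\<close> splits into
  \<open>\<epsilon> * \<theta>\<^sup>2 / K\<close> and \<open>\<epsilon> / K\<close>, both at most
  1/4.\<close>

lemma cross_term_le: "\<bar>2 * (\<epsilon> * \<theta> / K) * (u t \<bullet> v t)\<bar> \<le> (u t \<bullet> u t + v t \<bullet> v t) / 4"
proof -
  have "(\<epsilon> * \<theta> / K)\<^sup>2 = (\<epsilon> * \<theta>\<^sup>2 / K) * (\<epsilon> / K)"
    by (simp add: power2_eq_square field_simps)
  also have "\<dots> \<le> (1 / 4) * (1 / 4)"
    using rate_le \<epsilon> K by (intro mult_mono) (auto simp: field_simps)
  finally have "(\<epsilon> * \<theta> / K)\<^sup>2 \<le> (1 / 4)\<^sup>2" by (simp add: power2_eq_square)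
  then have 1: "\<bar>\<epsilon> * \<theta> / K\<bar> \<le> 1 / 4" using abs_le_square_iff[of "\<epsilon> * \<theta> / K" "1 / 4"] by simp
  have 2: "2 * \<bar>u t \<bullet> v t\<bar> \<le> u t \<bullet> u t + v t \<bullet> v t"
    using inner_ge_zero[of "u t + v t"] inner_ge_zero[of "u t - v t"]
    by (auto simp: inner_add_left inner_add_right inner_diff_left inner_diff_right inner_commute)
  have "\<bar>2 * (\<epsilon> * \<theta> / K) * (u t \<bullet> v t)\<bar> = \<bar>\<epsilon> * \<theta> / K\<bar> * (2 * \<bar>u t \<bullet> v t\<bar>)"
    by (simp add: abs_mult)
  also have "\<dots> \<le> (1 / 4) * (u t \<bullet> u t + v t \<bullet> v t)"
    by (intro mult_mono 1 2) auto
  finally show ?thesis by simp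
qed

lemma energy_decay:
  assumes t: "t \<ge> 0"
  shows "u t \<bullet> u t + v t \<bullet> v t
    \<le> 4 * exp (- (\<epsilon> * \<theta>\<^sup>2 / (2 * K)) * t) * (u 0 \<bullet> u 0 + v 0 \<bullet> v 0)"
proof -
  define E where "E = (\<lambda>t. u t \<bullet> u t + v t \<bullet> v t)"
  define L where "L = (\<lambda>t. E t - 2 * (\<epsilon> * \<theta> / K) * (u t \<bullet> v t))"
  define L' where "L' = (\<lambda>t. (- 2 * K * (u t \<bullet> u t) + 2 * \<theta> * (u t \<bullet> v t)) - 2 * \<theta> * (u t \<bullet> v t)
     - 2 * (\<epsilon> * \<theta> / K) * (- K * (u t \<bullet> v t) + \<theta> * (v t \<bullet> v t) - \<theta> * (u t \<bullet> u t)))"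
  have L_E: "L t \<le> 2 * E t" "E t \<le> 2 * L t" for t
  proof -
    have "\<bar>E t - L t\<bar> \<le> E t / 4" using cross_term_le[of t] by (simp add: L_def E_def)
    moreover have "E t \<ge> 0" by (simp add: E_def)
    ultimately show "L t \<le> 2 * E t" "E t \<le> 2 * L t" by linarith+
  qed
  have E_nonneg: "E t \<ge> 0" for t by (simp add: E_def)
  have "L t \<le> exp (- (\<epsilon> * \<theta>\<^sup>2 / (2 * K)) * t) * L 0"
  proof (rule differential_decay[where f' = L', OF _ _ t])
    fix t :: real assume t: "t \<ge> 0"
    show "(L has_real_derivative L' t) (at t within {0..})"
      unfolding L_def E_def L'_def
      by (rule derivative_eq_intros inner_derivatives[OF t] refl | simp)+
    let ?p = "u t \<bullet> u t" and ?q = "v t \<bullet> v t"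
    \<comment> \<open>Young's inequality, weighted so that the cross term costs only half of the
      damping \<open>2 * K\<close> of \<open>u\<close>.\<close>
    have "0 \<le> (K *\<^sub>R u t - (\<epsilon> * \<theta>) *\<^sub>R v t) \<bullet> (K *\<^sub>R u t - (\<epsilon> * \<theta>) *\<^sub>R v t) / K"
      using K by (intro divide_nonneg_pos inner_ge_zero) auto
    also have "\<dots> = K * ?p - 2 * \<epsilon> * \<theta> * (u t \<bullet> v t) + \<epsilon>\<^sup>2 * \<theta>\<^sup>2 / K * ?q"
      using K by (simp add: inner_diff_left inner_diff_right inner_commute field_simps power2_eq_square)
    finally have young: "2 * \<epsilon> * \<theta> * (u t \<bullet> v t) \<le> K * ?p + \<epsilon>\<^sup>2 * \<theta>\<^sup>2 / K * ?q" by simp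
    have L': "L' t = - 2 * K * ?p + 2 * \<epsilon> * \<theta> * (u t \<bullet> v t)
        - 2 * (\<epsilon> * \<theta>\<^sup>2 / K) * ?q + 2 * (\<epsilon> * \<theta>\<^sup>2 / K) * ?p"
      using K by (simp add: L'_def field_simps power2_eq_square)
    have "\<epsilon>\<^sup>2 * \<theta>\<^sup>2 / K = \<epsilon> * (\<epsilon> * \<theta>\<^sup>2 / K)" by (simp add: power2_eq_square)
    also have "\<dots> \<le> \<epsilon> * \<theta>\<^sup>2 / K"
      using \<epsilon> K mult_right_mono[of \<epsilon> 1 "\<epsilon> * \<theta>\<^sup>2 / K"] by simp
    finally have 1: "\<epsilon>\<^sup>2 * \<theta>\<^sup>2 / K * ?q \<le> \<epsilon> * \<theta>\<^sup>2 / K * ?q" by (rule mult_right_mono) simp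
    have 2: "\<epsilon> * \<theta>\<^sup>2 / K * ?p \<le> (1/4) * ?p" by (rule mult_right_mono[OF rate_le]) simp
    have 3: "?p \<le> K * ?p" using K mult_right_mono[of 1 K ?p] by simp
    \<comment> \<open>The cross term of the Lyapunov function yields \<open>- 2 * d\<close> times
      \<open>?q\<close>. Young's inequality gives back one \<open>d\<close>, and the remaining
      damping \<open>K * ?p\<close> absorbs \<open>3 * (d * ?p)\<close> since
      \<open>d \<le> 1/4\<close>.\<close>
    define d where "d = \<epsilon> * \<theta>\<^sup>2 / K"
    have 4: "2 * \<epsilon> * \<theta> * (u t \<bullet> v t) \<le> K * ?p + d * ?q"
      using young 1 unfolding d_def by (rule order_trans[OF _ add_left_mono])
    have "4 * (d * ?p) \<le> ?p" "0 \<le> ?p" using 2 unfolding d_def[symmetric] by simp_all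
    with 3 have "3 * (d * ?p) \<le> K * ?p" by linarith
    with 4 have "L' t \<le> - d * ?p - d * ?q"
      unfolding L' d_def[symmetric] by (simp add: mult.assoc)
    \<comment> \<open>Passing from \<open>E\<close> to \<open>L\<close> by
      \<open>L \<le> 2 * E\<close> halves the rate.\<close>
    also have "\<dots> = - (\<epsilon> * \<theta>\<^sup>2 / (2 * K)) * (2 * E t)" using K by (simp add: E_def d_def field_simps)
    also have "\<dots> \<le> - (\<epsilon> * \<theta>\<^sup>2 / (2 * K)) * L t"
      using L_E \<epsilon> K by (intro mult_left_mono_neg) auto
    finally show "L' t \<le> - (\<epsilon> * \<theta>\<^sup>2 / (2 * K)) * L t" .
  qed
  moreover have "exp (- (\<epsilon> * \<theta>\<^sup>2 / (2 * K)) * t) * L 0 \<le> exp (- (\<epsilon> * \<theta>\<^sup>2 / (2 * K)) * t) * (2 * E 0)"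
    by (intro mult_left_mono L_E) auto
  ultimately have "E t \<le> 4 * exp (- (\<epsilon> * \<theta>\<^sup>2 / (2 * K)) * t) * E 0" using L_E(2)[of t] by linarith
  then show ?thesis by (simp add: E_def)
qed

text \<open>By Young's inequality the square of \<open>u\<close> is damped at rate \<open>K\<close>
  and forced by \<open>\<theta>\<^sup>2 / K\<close> times the square of \<open>v\<close>, which
  \<open>energy_decay\<close> controls. Since the forcing decays more slowly than the damping acts,
  \<open>u\<close> follows it with a further factor \<open>1 / K\<close>.\<close>

lemma velocity_decay:
  assumes t: "t \<ge> 0"
  shows "u t \<bullet> u t \<le> (exp (- K * t) + 8 * \<theta>\<^sup>2 / K\<^sup>2 * exp (- (\<epsilon> * \<theta>\<^sup>2 / (2 * K)) * t))
    * (u 0 \<bullet> u 0 + v 0 \<bullet> v 0)"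
proof -
  define E0 where "E0 = u 0 \<bullet> u 0 + v 0 \<bullet> v 0"
  define \<sigma> where "\<sigma> = \<epsilon> * \<theta>\<^sup>2 / (2 * K)"
  \<comment> \<open>\<open>A\<close> is chosen so that the forcing is at most
    \<open>K / 2 * A * exp (- \<sigma> * t)\<close>. The derivative of the comparison term costs
    another such half because \<open>\<sigma> \<le> K / 2\<close>; together they give
    \<open>G' \<le> - K * G\<close>.\<close>
  define A where "A = 8 * \<theta>\<^sup>2 / K\<^sup>2 * E0"
  define G where "G = (\<lambda>t. u t \<bullet> u t - A * exp (- \<sigma> * t))"
  define G' where "G' = (\<lambda>t. - 2 * K * (u t \<bullet> u t) + 2 * \<theta> * (u t \<bullet> v t) + A * \<sigma> * exp (- \<sigma> * t))"
  have E0: "E0 \<ge> 0" and A: "A \<ge> 0" by (simp_all add: E0_def A_def)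
  have "G t \<le> exp (- K * t) * G 0"
  proof (rule differential_decay[where f' = G', OF _ _ t])
    fix t :: real assume t: "t \<ge> 0"
    show "(G has_real_derivative G' t) (at t within {0..})"
      unfolding G_def G'_def
      by (rule derivative_eq_intros inner_derivatives[OF t] refl | simp)+
    let ?p = "u t \<bullet> u t" and ?q = "v t \<bullet> v t"
    have "0 \<le> (K *\<^sub>R u t - \<theta> *\<^sub>R v t) \<bullet> (K *\<^sub>R u t - \<theta> *\<^sub>R v t) / K"
      using K by (intro divide_nonneg_pos inner_ge_zero) auto
    also have "\<dots> = K * ?p - 2 * \<theta> * (u t \<bullet> v t) + \<theta>\<^sup>2 / K * ?q"
      using K by (simp add: inner_diff_left inner_diff_right inner_commute field_simps power2_eq_square)
    finally have young: "2 * \<theta> * (u t \<bullet> v t) \<le> K * ?p + \<theta>\<^sup>2 / K * ?q" by simp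
    have "?q \<le> 4 * exp (- \<sigma> * t) * E0"
      using energy_decay[OF t] inner_ge_zero[of "u t"] unfolding \<sigma>_def E0_def by linarith
    then have "\<theta>\<^sup>2 / K * ?q \<le> \<theta>\<^sup>2 / K * (4 * exp (- \<sigma> * t) * E0)"
      using K by (intro mult_left_mono) auto
    also have "\<dots> = K / 2 * A * exp (- \<sigma> * t)"
      using K by (simp add: A_def field_simps power2_eq_square)
    finally have 1: "\<theta>\<^sup>2 / K * ?q \<le> K / 2 * A * exp (- \<sigma> * t)" .
    have "\<sigma> = (\<epsilon> * \<theta>\<^sup>2 / K) * (1 / 2)" by (simp add: \<sigma>_def)
    also have "\<dots> \<le> K * (1 / 2)" by (rule mult_right_mono[OF order_trans[OF rate_le]]) (use K in auto)
    finally have "\<sigma> \<le> K / 2" by simp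
    then have 2: "A * \<sigma> * exp (- \<sigma> * t) \<le> K / 2 * A * exp (- \<sigma> * t)"
      using A mult_left_mono[of \<sigma> "K / 2" A] by (intro mult_right_mono) (auto simp: mult.commute)
    show "G' t \<le> - K * G t"
      using young 1 2 by (simp add: G'_def G_def algebra_simps)
  qed
  also have "\<dots> \<le> exp (- K * t) * E0"
    using A by (intro mult_left_mono) (auto simp: G_def E0_def intro: order_trans[OF _ inner_ge_zero])
  finally show ?thesis by (simp add: G_def A_def E0_def \<sigma>_def algebra_simps)
qed

end

end

section \<open>Trigonometric test functions and Fourier modes\<close>

definition trig :: "real \<Rightarrow> real \<Rightarrow> int ^ 'n \<Rightarrow> real ^ 'n \<Rightarrow> real" where
  "trig a c k x = a * cos (freq k \<bullet> x) + c * sin (freq k \<bullet> x)"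

lemma trig_has_derivative:
  "(trig a c k has_derivative (\<lambda>h. (c * cos (freq k \<bullet> x) - a * sin (freq k \<bullet> x)) * (freq k \<bullet> h))) (at x)"
  unfolding trig_def by (auto intro!: derivative_eq_intros simp: algebra_simps)

lemma pd_trig: "pd i (trig a c k) = trig (c * freq k $ i) (- a * freq k $ i) k"
  by (rule ext) (simp add: pd_def trig_def inner_axis algebra_simps
      flip: frechet_derivative_at[OF trig_has_derivative])

text \<open>Partial derivatives only change the two coefficients, so the induction runs with
  \<open>a\<close> and \<open>c\<close> arbitrary.\<close>

lemma Ck_trig: "Ck n (trig a c k)"
proof (induction n arbitrary: a c)
  case 0
  show ?case by (auto simp: trig_def intro!: continuous_intros)
next
  case (Suc n)
  then show ?case using trig_has_derivative[of a c k] by (auto simp: pd_trig differentiable_def)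
qed

lemma test_function_trig: "test_function (trig a c k)"
proof -
  have "trig a c k (x + axis i (2 * pi)) = trig a c k x" for x i
  proof -
    have "freq k \<bullet> (x + axis i (2 * pi)) = freq k \<bullet> x + 2 * pi * of_int (k $ i)"
      by (simp add: inner_add_right inner_axis freq_def)
    moreover have "cos (2 * pi * of_int (k $ i)) = 1" "sin (2 * pi * of_int (k $ i)) = 0"
      by (simp_all add: cos_int_2pin sin_int_2pin)
    ultimately show ?thesis by (simp add: trig_def cos_add sin_add)
  qed
  then show ?thesis by (simp add: test_function_def torus_periodic_def Ck_trig)
qed

lemma inner_grad_trig: "b \<bullet> grad (trig a c k) x = trig (c * (b \<bullet> freq k)) (- a * (b \<bullet> freq k)) k x"
  by (simp add: grad_def pd_trig inner_vec_def trig_def sum_distrib_left sum_distrib_right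
      sum_subtractf sum_negf algebra_simps)

lemma laplacian_trig:
  "laplacian (trig a c k) x = trig (- (norm (freq k))\<^sup>2 * a) (- (norm (freq k))\<^sup>2 * c) k x"
  unfolding power2_norm_eq_inner
  by (simp add: laplacian_def pd_trig inner_vec_def trig_def sum_distrib_left sum_distrib_right
      sum_subtractf sum_negf algebra_simps sum.distrib)

text \<open>Together with \<open>sin_mode\<close>, the real and the negated imaginary part of the
  Fourier coefficient without its normalising factor; this keeps the mode equations real.\<close>

definition cos_mode :: "(real ^ 'n \<Rightarrow> real ^ 'n) \<Rightarrow> int ^ 'n \<Rightarrow> real ^ 'n" where
  "cos_mode f k = (LINT x|lebesgue_on torus. cos (freq k \<bullet> x) *\<^sub>R f x)"

definition sin_mode :: "(real ^ 'n \<Rightarrow> real ^ 'n) \<Rightarrow> int ^ 'n \<Rightarrow> real ^ 'n" where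
  "sin_mode f k = (LINT x|lebesgue_on torus. sin (freq k \<bullet> x) *\<^sub>R f x)"

lemma L2_torus_integrable:
  fixes f :: "real ^ 'n \<Rightarrow> real ^ 'n"
  assumes "f \<in> L2_torus"
  shows "integrable (lebesgue_on torus) f"
proof -
  have f: "f \<in> borel_measurable (lebesgue_on torus)"
    and i: "integrable (lebesgue_on torus) (\<lambda>x. (norm (f x))\<^sup>2)"
    using assms by (auto simp: L2_torus_def)
  interpret finite_measure "lebesgue_on (torus :: (real ^ 'n) set)"
    by (rule finite_measure_lebesgue_on) (simp add: torus_def)
  have "integrable (lebesgue_on torus) (\<lambda>x. 1 + (norm (f x))\<^sup>2)" using i by simp
  \<comment> \<open>On a cell of finite measure, square integrability gives integrability through
    this pointwise bound.\<close>
  moreover have "norm (f x) \<le> norm (1 + (norm (f x))\<^sup>2)" for x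
    using sum_squares_bound[of "norm (f x)" 1] by (simp add: abs_of_nonneg add_nonneg_nonneg)
      (smt (verit) norm_ge_zero)
  ultimately show ?thesis using f by (auto intro: Bochner_Integration.integrable_bound)
qed

lemma
  fixes f :: "real ^ 'n \<Rightarrow> 'a :: {banach, second_countable_topology}"
  assumes f: "integrable (lebesgue_on torus) f"
  shows integrable_cos: "integrable (lebesgue_on torus) (\<lambda>x. cos (w \<bullet> x) *\<^sub>R f x)"
    and integrable_sin: "integrable (lebesgue_on torus) (\<lambda>x. sin (w \<bullet> x) *\<^sub>R f x)"
proof -
  have m: "(\<lambda>x. cos (w \<bullet> x)) \<in> borel_measurable (lebesgue_on torus)"
    "(\<lambda>x. sin (w \<bullet> x)) \<in> borel_measurable (lebesgue_on torus)"
    by (intro continuous_imp_measurable_on_sets_lebesgue continuous_intros; simp add: torus_def)+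
  show "integrable (lebesgue_on torus) (\<lambda>x. cos (w \<bullet> x) *\<^sub>R f x)"
    "integrable (lebesgue_on torus) (\<lambda>x. sin (w \<bullet> x) *\<^sub>R f x)"
    using m borel_measurable_integrable[OF f]
    by (auto intro!: Bochner_Integration.integrable_bound[OF f] mult_left_le_one_le AE_I2)
qed

lemma integral_trig:
  assumes "f \<in> L2_torus"
  shows "integrable (lebesgue_on torus) (\<lambda>x. trig a c k x *\<^sub>R f x)"
    and "(LINT x|lebesgue_on torus. trig a c k x *\<^sub>R f x) = a *\<^sub>R cos_mode f k + c *\<^sub>R sin_mode f k"
  using integrable_cos[OF L2_torus_integrable[OF assms], of "freq k"]
    integrable_sin[OF L2_torus_integrable[OF assms], of "freq k"]
  by (simp_all add: trig_def scaleR_add_left cos_mode_def sin_mode_def flip: scaleR_scaleR)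

lemma norm_fourier_coeff:
  fixes f :: "real ^ 'n \<Rightarrow> real ^ 'n"
  assumes "f \<in> L2_torus"
  shows "(norm (fourier_coeff f k))\<^sup>2 =
    (cos_mode f k \<bullet> cos_mode f k + sin_mode f k \<bullet> sin_mode f k) / ((2 * pi) ^ CARD('n))\<^sup>2"
proof -
  note c = integrable_cos[OF L2_torus_integrable[OF assms], of "freq k"]
  note s = integrable_sin[OF L2_torus_integrable[OF assms], of "freq k"]
  let ?N = "(2 * pi) ^ CARD('n)"
  have "fourier_coeff f k $ j = Complex (cos_mode f k $ j) (- sin_mode f k $ j) / of_real ?N" for j
  proof -
    have ic: "integrable (lebesgue_on torus) (\<lambda>x. cos (freq k \<bullet> x) * f x $ j)"
      and ec: "(LINT x|lebesgue_on torus. cos (freq k \<bullet> x) * f x $ j) = cos_mode f k $ j"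
      using integrable_bounded_linear[OF bounded_linear_vec_nth c]
        integral_bounded_linear[OF bounded_linear_vec_nth c]
      by (simp_all add: cos_mode_def)
    have i_s: "integrable (lebesgue_on torus) (\<lambda>x. sin (freq k \<bullet> x) * f x $ j)"
      and es: "(LINT x|lebesgue_on torus. sin (freq k \<bullet> x) * f x $ j) = sin_mode f k $ j"
      using integrable_bounded_linear[OF bounded_linear_vec_nth s]
        integral_bounded_linear[OF bounded_linear_vec_nth s]
      by (simp_all add: sin_mode_def)
    have "exp (- \<i> * of_real (freq k \<bullet> x)) = cis (- (freq k \<bullet> x))" for x
      by (simp add: cis_conv_exp)
    then have "exp (- \<i> * of_real (freq k \<bullet> x)) * of_real (f x $ j) =
        of_real (cos (freq k \<bullet> x) * f x $ j) - \<i> * of_real (sin (freq k \<bullet> x) * f x $ j)" for x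
      by (simp add: complex_eq_iff)
    then have "(LINT x|lebesgue_on torus. exp (- \<i> * of_real (freq k \<bullet> x)) * of_real (f x $ j)) =
        of_real (cos_mode f k $ j) - \<i> * of_real (sin_mode f k $ j)"
      using ic i_s by (simp del: of_real_mult add: integral_complex_of_real ec es)
    then show ?thesis by (simp add: fourier_coeff_def complex_eq_iff)
  qed
  then have "(norm (fourier_coeff f k $ j))\<^sup>2 = ((cos_mode f k $ j)\<^sup>2 + (sin_mode f k $ j)\<^sup>2) / ?N\<^sup>2" for j
    by (simp add: norm_divide cmod_def power_divide add_divide_distrib)
  then show ?thesis
    by (simp add: norm_vec_def L2_set_def sum_nonneg inner_vec_def power2_eq_square sum.distrib
        flip: sum_divide_distrib)
qed

section \<open>Trading Sobolev weight for decay in time\<close>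

lemma powr_le_exp:
  fixes p :: real
  assumes "p \<ge> 0"
  obtains C where "C > 0" "\<And>x. x \<ge> 0 \<Longrightarrow> (1 + x) powr p * exp (- x) \<le> C"
proof
  \<comment> \<open>The constant is the value at the critical point \<open>1 + x = p\<close>; the
    bound is the tangent inequality for \<open>ln\<close> at 1, applied to
    \<open>(1 + x) / p\<close>.\<close>
  show "exp (1 - p + p * ln p) > 0" by simp
  fix x :: real
  assume x: "x \<ge> 0"
  have "p * ln (1 + x) \<le> 1 + x - p + p * ln p"
  proof (cases "p = 0")
    case False
    with assms have p: "p > 0" by simp
    have "ln ((1 + x) / p) \<le> (1 + x) / p - 1"
      using x p by (intro ln_le_minus_one) simp
    then have "p * ln ((1 + x) / p) \<le> p * ((1 + x) / p - 1)" using p by (intro mult_left_mono) auto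
    also have "p * ((1 + x) / p - 1) = 1 + x - p" using p by (simp add: right_diff_distrib)
    finally show ?thesis using x p by (simp add: ln_div right_diff_distrib)
  qed (use x in simp)
  then have "exp (p * ln (1 + x) - x) \<le> exp (1 - p + p * ln p)" by simp
  moreover have "(1 + x) powr p * exp (- x) = exp (p * ln (1 + x) - x)"
    using x by (simp add: powr_def exp_diff exp_minus field_simps)
  ultimately show "(1 + x) powr p * exp (- x) \<le> exp (1 - p + p * ln p)" by simp
qed

text \<open>With \<open>x\<close> the decay rate times \<open>t\<close>, the lower bound on
  \<open>\<theta>\<^sup>2\<close> gives
  \<open>1 + t \<le> M * (1 + x) * (1 + K) powr (1 + r)\<close>. Powers of \<open>1 + t\<close> thus
  become powers of \<open>1 + x\<close>, which \<open>exp (- x)\<close> absorbs, and powers of the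
  weight.\<close>

lemma weighted_mode_decay:
  fixes \<beta> c r s m :: real
  assumes \<beta>: "\<beta> \<ge> 0" and c: "c > 0" and r: "r > - 1" and s: "s \<le> m"
  obtains C where "C > 0"
    and "\<And>(u :: real \<Rightarrow> 'a::real_inner) v K \<theta> t. \<lbrakk>damped_pair u v K \<theta>; K \<ge> 1; \<theta>\<^sup>2 \<le> \<beta> * K; c * K powr - r \<le> \<theta>\<^sup>2; t \<ge> 0\<rbrakk> \<Longrightarrow>
       (1 + K) powr s * (u t \<bullet> u t) \<le> C * (1 + t) powr - (1 + (m - s + 1) / (1 + r)) *
           ((1 + K) powr m * (u 0 \<bullet> u 0 + v 0 \<bullet> v 0))"
    and "\<And>(u :: real \<Rightarrow> 'a::real_inner) v K \<theta> t. \<lbrakk>damped_pair u v K \<theta>; K \<ge> 1; \<theta>\<^sup>2 \<le> \<beta> * K; c * K powr - r \<le> \<theta>\<^sup>2; t \<ge> 0\<rbrakk> \<Longrightarrow>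
       (1 + K) powr s * (v t \<bullet> v t) \<le> C * (1 + t) powr - ((m - s) / (1 + r)) *
           ((1 + K) powr m * (u 0 \<bullet> u 0 + v 0 \<bullet> v 0))"
proof -
  define \<epsilon> where "\<epsilon> = 1 / (4 * (1 + \<beta>))"
  define M where "M = 1 + 2 / (\<epsilon> * c)"
  define p where "p = (m - s) / (1 + r)"
  define q where "q = (m - s + 1) / (1 + r)"
  have \<epsilon>: "0 < \<epsilon>" "\<epsilon> \<le> 1 / 4" "4 * \<epsilon> * \<beta> \<le> 1" using \<beta> by (simp_all add: \<epsilon>_def field_simps)
  have M: "M \<ge> 1" using \<epsilon> c by (simp add: M_def)
  have p: "p \<ge> 0" and q: "q \<ge> 0" using s r by (simp_all add: p_def q_def)
  obtain Cp where Cp: "Cp > 0" "\<And>x. x \<ge> 0 \<Longrightarrow> (1 + x) powr p * exp (- x) \<le> Cp"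
    using powr_le_exp[OF p] by blast
  have q1: "1 + q \<ge> 0" using q by simp
  obtain Cq where Cq: "Cq > 0" "\<And>x. x \<ge> 0 \<Longrightarrow> (1 + x) powr (1 + q) * exp (- x) \<le> Cq"
    using powr_le_exp[OF q1] by blast
  \<comment> \<open>The first summand serves the part decaying like \<open>exp (- K * t)\<close>. In
    the second, 16 is the 8 of \<open>velocity_decay\<close> times the 2 of
    \<open>W \<le> 2 * K\<close>. The 4 in \<open>Cv\<close> comes from
    \<open>energy_decay\<close>.\<close>
  define Cu where "Cu = Cq + 16 * (\<beta> + 2 / \<epsilon>) * M powr q * Cq"
  define Cv where "Cv = 4 * M powr p * Cp"
  have Cu: "Cu > 0" unfolding Cu_def using Cq \<beta> \<epsilon> by (intro add_pos_nonneg) auto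
  have Cv: "Cv > 0" unfolding Cv_def using Cp M by auto
  have main: "(u t \<bullet> u t) \<le> Cu * (1 + t) powr - (1 + q) * ((1 + K) powr (m - s) * (u 0 \<bullet> u 0 + v 0 \<bullet> v 0))"
      "(v t \<bullet> v t) \<le> Cv * (1 + t) powr - p * ((1 + K) powr (m - s) * (u 0 \<bullet> u 0 + v 0 \<bullet> v 0))"
    if uv: "damped_pair u v K \<theta>" and K: "K \<ge> 1" and \<theta>: "\<theta>\<^sup>2 \<le> \<beta> * K" "c * K powr - r \<le> \<theta>\<^sup>2" and t: "t \<ge> 0"
    for u v :: "real \<Rightarrow> 'a" and K \<theta> t
  proof -
    define W where "W = 1 + K"
    define x where "x = \<epsilon> * \<theta>\<^sup>2 / (2 * K) * t"
    define E0 where "E0 = u 0 \<bullet> u 0 + v 0 \<bullet> v 0"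
    have W: "W \<ge> 1" "W \<le> 2 * K" and E0: "E0 \<ge> 0" using K by (simp_all add: W_def E0_def)
    have x: "x \<ge> 0" using K \<epsilon> t by (simp add: x_def)
    have "\<epsilon> * c / 2 * t \<le> x * W powr (1 + r)"
    proof -
      have "W powr (1 + r) * (K powr - r / K) \<ge> K powr (1 + r) * (K powr - r / K)"
        using K r by (intro mult_right_mono powr_mono2) (auto simp: W_def)
      also have "K powr (1 + r) * (K powr - r / K) = 1"
        using K by (simp add: powr_add powr_minus field_simps)
      finally have "\<epsilon> * c / 2 * t * 1 \<le> \<epsilon> * c / 2 * t * (W powr (1 + r) * (K powr - r / K))"
        using \<epsilon> c t by (intro mult_left_mono) auto
      also have "\<dots> = \<epsilon> * (c * K powr - r) / (2 * K) * t * W powr (1 + r)" by (simp add: field_simps)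
      also have "\<dots> \<le> x * W powr (1 + r)"
        unfolding x_def using \<theta> \<epsilon> K t
        by (intro mult_right_mono divide_right_mono mult_left_mono) auto
      finally show ?thesis by simp
    qed
    then have "t \<le> (2 / (\<epsilon> * c)) * (x * W powr (1 + r))" using \<epsilon> c by (simp add: field_simps)
    moreover have "1 \<le> W powr (1 + r)" using W r by (simp add: ge_one_powr_ge_zero)
    moreover have "0 \<le> 2 / (\<epsilon> * c) * W powr (1 + r)" "0 \<le> x * W powr (1 + r)"
      using \<epsilon> c x by auto
    \<comment> \<open>The right side is the expanded product
      \<open>M * (1 + x) * W powr (1 + r)\<close>.\<close>
    ultimately have "1 + t \<le> W powr (1 + r) + x * W powr (1 + r)
        + 2 / (\<epsilon> * c) * W powr (1 + r) + (2 / (\<epsilon> * c)) * (x * W powr (1 + r))"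
      by linarith
    also have "\<dots> = M * (1 + x) * W powr (1 + r)" by (simp add: M_def distrib_left distrib_right)
    finally have time: "1 + t \<le> M * (1 + x) * W powr (1 + r)" .
    have time_powr: "(1 + t) powr a \<le> M powr a * (1 + x) powr a * W powr ((1 + r) * a)" if "a \<ge> 0" for a
      using powr_mono2[OF that _ time] t M x W
      by (simp add: powr_mult powr_powr)
    have "v t \<bullet> v t \<le> 4 * exp (- x) * E0"
      using damped_pair.energy_decay[OF uv K \<theta>(1) \<epsilon> t] inner_ge_zero[of "u t"]
      unfolding x_def E0_def mult_minus_left by linarith
    also have "exp (- x) \<le> M powr p * Cp * W powr (m - s) * (1 + t) powr - p"
    proof -
      have "(1 + t) powr p * exp (- x) \<le> M powr p * (1 + x) powr p * W powr ((1 + r) * p) * exp (- x)"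
        using time_powr[OF p] by (intro mult_right_mono) auto
      also have "\<dots> = M powr p * W powr ((1 + r) * p) * ((1 + x) powr p * exp (- x))" by simp
      also have "\<dots> \<le> M powr p * W powr ((1 + r) * p) * Cp"
        using Cp(2)[OF x] by (intro mult_left_mono) auto
      also have "(1 + r) * p = m - s" using r by (simp add: p_def)
      finally show ?thesis using t by (simp add: powr_minus field_simps)
    qed
    finally have V: "v t \<bullet> v t \<le> Cv * (1 + t) powr - p * (W powr (m - s) * E0)"
      using E0 by (simp add: Cv_def mult_right_mono algebra_simps)
    have "exp (- K * t) \<le> Cq * (1 + t) powr - (1 + q) * W powr (m - s)"
    proof -
      have "exp (- K * t) \<le> exp (- t)" using K t mult_right_mono[of 1 K t] by simp
      also have "\<dots> \<le> Cq * (1 + t) powr - (1 + q)"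
        using Cq(2)[OF t] t by (simp only: powr_minus) (simp add: field_simps)
      also have "\<dots> \<le> \<dots> * W powr (m - s)"
        using Cq W s mult_left_mono[of 1 "W powr (m - s)" "Cq * (1 + t) powr - (1 + q)"]
        by (simp add: ge_one_powr_ge_zero)
      finally show ?thesis .
    qed
    moreover have "8 * \<theta>\<^sup>2 / K\<^sup>2 * exp (- x)
        \<le> 16 * (\<beta> + 2 / \<epsilon>) * M powr q * Cq * (1 + t) powr - (1 + q) * W powr (m - s)"
    proof -
      \<comment> \<open>The source of the faster decay of \<open>u\<close>: one factor
        \<open>\<theta>\<^sup>2 / K\<close> pays for a full power of \<open>1 + t\<close> without
        any weight. The other \<open>1 / K\<close> later cancels the surplus in
        \<open>(1 + r) * q = m - s + 1\<close>.\<close>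
      have "\<theta>\<^sup>2 / K * (1 + t) = \<theta>\<^sup>2 / K + 2 / \<epsilon> * x"
        using \<epsilon> K by (simp add: x_def field_simps)
      also have "\<dots> \<le> \<beta> + 2 / \<epsilon> * x" using \<theta> K by (simp add: field_simps)
      also have "\<dots> \<le> (\<beta> + 2 / \<epsilon>) * (1 + x)"
        using \<beta> \<epsilon> x by (simp add: distrib_left distrib_right)
      finally have 1: "\<theta>\<^sup>2 / K * (1 + t) \<le> (\<beta> + 2 / \<epsilon>) * (1 + x)" .
      have "8 * \<theta>\<^sup>2 / K\<^sup>2 * exp (- x) * (1 + t) powr (1 + q)
          = 8 / K * (\<theta>\<^sup>2 / K * (1 + t)) * (1 + t) powr q * exp (- x)"
        using t by (simp add: powr_add power2_eq_square)
      also have "\<dots> \<le> 8 / K * ((\<beta> + 2 / \<epsilon>) * (1 + x)) *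
            (M powr q * (1 + x) powr q * W powr ((1 + r) * q)) * exp (- x)"
        using K \<beta> \<epsilon> x
        by (intro mult_right_mono mult_mono[OF mult_left_mono[OF 1] time_powr[OF q]]) auto
      also have "\<dots> = 8 / K * ((\<beta> + 2 / \<epsilon>) * M powr q * W powr ((1 + r) * q)) *
            ((1 + x) powr (1 + q) * exp (- x))"
        using x by (simp add: powr_add)
      also have "\<dots> \<le> 8 / K * ((\<beta> + 2 / \<epsilon>) * M powr q * W powr ((1 + r) * q)) * Cq"
        using K \<beta> \<epsilon> Cq(2)[OF x] by (intro mult_left_mono) auto
      also have "\<dots> \<le> 16 / W * ((\<beta> + 2 / \<epsilon>) * M powr q * W powr ((1 + r) * q)) * Cq"
        using K \<beta> \<epsilon> Cq W by (intro mult_right_mono) (auto simp: field_simps)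
      also have "(1 + r) * q = (m - s) + 1" using r by (simp add: q_def)
      also have "16 / W * ((\<beta> + 2 / \<epsilon>) * M powr q * W powr ((m - s) + 1)) * Cq
          = 16 * (\<beta> + 2 / \<epsilon>) * M powr q * Cq * W powr (m - s)"
        using W by (simp add: powr_add)
      finally show ?thesis using t by (simp only: powr_minus) (simp add: field_simps)
    qed
    ultimately have "exp (- K * t) + 8 * \<theta>\<^sup>2 / K\<^sup>2 * exp (- x)
        \<le> Cu * (1 + t) powr - (1 + q) * W powr (m - s)"
      unfolding Cu_def distrib_right by (rule add_mono)
    then have "(exp (- K * t) + 8 * \<theta>\<^sup>2 / K\<^sup>2 * exp (- x)) * E0
        \<le> Cu * (1 + t) powr - (1 + q) * W powr (m - s) * E0"
      using E0 by (rule mult_right_mono)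
    moreover have "u t \<bullet> u t \<le> (exp (- K * t) + 8 * \<theta>\<^sup>2 / K\<^sup>2 * exp (- x)) * E0"
      using damped_pair.velocity_decay[OF uv K \<theta>(1) \<epsilon> t] by (simp only: x_def E0_def mult_minus_left)
    ultimately have U: "u t \<bullet> u t \<le> Cu * (1 + t) powr - (1 + q) * (W powr (m - s) * E0)"
      by (simp only: mult.assoc)
    show "(u t \<bullet> u t) \<le> Cu * (1 + t) powr - (1 + q) * ((1 + K) powr (m - s) * (u 0 \<bullet> u 0 + v 0 \<bullet> v 0))"
      "(v t \<bullet> v t) \<le> Cv * (1 + t) powr - p * ((1 + K) powr (m - s) * (u 0 \<bullet> u 0 + v 0 \<bullet> v 0))"
      using U V by (simp_all add: W_def E0_def)
  qed
  \<comment> \<open>Multiplying by \<open>(1 + K) powr s\<close> turns the weight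
    \<open>m - s\<close> into \<open>m\<close>; \<open>Cu + Cv\<close> serves both
    estimates.\<close>
  have weight: "(1 + K) powr s * y \<le> (Cu + Cv) * D * ((1 + K) powr m * E)"
    if "y \<le> C * D * ((1 + K) powr (m - s) * E)" "C \<le> Cu + Cv" "K \<ge> 1" "D \<ge> 0" "E \<ge> 0"
    for y C D E K :: real
  proof -
    have "(1 + K) powr s * y \<le> (1 + K) powr s * (C * D * ((1 + K) powr (m - s) * E))"
      using that by (intro mult_left_mono) auto
    also have "\<dots> = C * (D * ((1 + K) powr m * E))" using that(3) by (simp add: powr_diff)
    also have "\<dots> \<le> (Cu + Cv) * (D * ((1 + K) powr m * E))"
      using that by (intro mult_right_mono) auto
    finally show ?thesis by (simp add: mult.assoc)
  qed
  show ?thesis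
  proof (rule that)
    show "Cu + Cv > 0" using Cu Cv by simp
  qed (rule weight[OF main(1)[unfolded q_def]] weight[OF main(2)[unfolded p_def]],
       use Cu Cv in \<open>simp_all\<close>)+
qed

section \<open>From the weak equations to Fourier modes\<close>

lemma linear_MHD_solution_modes:
  assumes sol: "linear_MHD_solution b U\<^sub>0 B\<^sub>0 U B"
  shows "damped_pair (\<lambda>t. cos_mode (U t) k) (\<lambda>t. sin_mode (B t) k) ((norm (freq k))\<^sup>2) (b \<bullet> freq k)"
    and "damped_pair (\<lambda>t. sin_mode (U t) k) (\<lambda>t. cos_mode (B t) k) ((norm (freq k))\<^sup>2) (- (b \<bullet> freq k))"
proof -
  let ?K = "(norm (freq k))\<^sup>2" and ?\<theta> = "b \<bullet> freq k"
  have L2: "U t \<in> L2_torus" "B t \<in> L2_torus" if "t \<ge> 0" for t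
    using sol that by (auto simp: linear_MHD_solution_def)
  note trig = test_function_trig[of _ _ k]
  \<comment> \<open>The Laplacian multiplies \<open>trig a c k\<close> by \<open>- ?K\<close>, while
    \<open>b \<bullet> grad\<close> exchanges sine and cosine with factor \<open>?\<theta>\<close>.
    Hence each mode of \<open>U\<close> couples to the opposite mode of \<open>B\<close>.\<close>
  have 1: "((\<lambda>t. a *\<^sub>R cos_mode (U t) k + c *\<^sub>R sin_mode (U t) k) has_vector_derivative
      - ?K *\<^sub>R (a *\<^sub>R cos_mode (U t) k + c *\<^sub>R sin_mode (U t) k)
      - ?\<theta> *\<^sub>R (c *\<^sub>R cos_mode (B t) k - a *\<^sub>R sin_mode (B t) k)) (at t within {0..})"
    if t: "t \<ge> 0" for t a c
  proof -
    have "((\<lambda>\<tau>. LINT x|lebesgue_on torus. trig a c k x *\<^sub>R U \<tau> x) has_vector_derivative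
           (LINT x|lebesgue_on torus. laplacian (trig a c k) x *\<^sub>R U t x
              - (b \<bullet> grad (trig a c k) x) *\<^sub>R B t x)) (at t within {0..})"
      using sol trig t unfolding linear_MHD_solution_def by blast
    also have "(LINT x|lebesgue_on torus. laplacian (trig a c k) x *\<^sub>R U t x
              - (b \<bullet> grad (trig a c k) x) *\<^sub>R B t x) =
        - ?K *\<^sub>R (a *\<^sub>R cos_mode (U t) k + c *\<^sub>R sin_mode (U t) k)
        - ?\<theta> *\<^sub>R (c *\<^sub>R cos_mode (B t) k - a *\<^sub>R sin_mode (B t) k)"
      using t by (simp add: laplacian_trig inner_grad_trig integral_trig L2 algebra_simps)
    \<comment> \<open>The integral splits into modes only for times in \<open>{0..}\<close>, where
      square integrability is known; the derivative within that set sees no other times.\<close>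
    finally show ?thesis
      by (rule has_vector_derivative_transform[rotated 2]) (use t in \<open>auto simp: integral_trig L2\<close>)
  qed
  have 2: "((\<lambda>t. a *\<^sub>R cos_mode (B t) k + c *\<^sub>R sin_mode (B t) k) has_vector_derivative
      - ?\<theta> *\<^sub>R (c *\<^sub>R cos_mode (U t) k - a *\<^sub>R sin_mode (U t) k)) (at t within {0..})"
    if t: "t \<ge> 0" for t a c
  proof -
    have "((\<lambda>\<tau>. LINT x|lebesgue_on torus. trig a c k x *\<^sub>R B \<tau> x) has_vector_derivative
           (LINT x|lebesgue_on torus. - (b \<bullet> grad (trig a c k) x) *\<^sub>R U t x)) (at t within {0..})"
      using sol trig t unfolding linear_MHD_solution_def by blast
    also have "(LINT x|lebesgue_on torus. - (b \<bullet> grad (trig a c k) x) *\<^sub>R U t x) =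
        - ?\<theta> *\<^sub>R (c *\<^sub>R cos_mode (U t) k - a *\<^sub>R sin_mode (U t) k)"
      using t by (simp add: inner_grad_trig integral_trig L2 algebra_simps)
    finally show ?thesis
      by (rule has_vector_derivative_transform[rotated 2]) (use t in \<open>auto simp: integral_trig L2\<close>)
  qed
  show "damped_pair (\<lambda>t. cos_mode (U t) k) (\<lambda>t. sin_mode (B t) k) ?K ?\<theta>"
    using 1[of _ 1 0] 2[of _ 0 1] by unfold_locales simp_all
  show "damped_pair (\<lambda>t. sin_mode (U t) k) (\<lambda>t. cos_mode (B t) k) ?K (- ?\<theta>)"
    using 1[of _ 0 1] 2[of _ 1 0] by unfold_locales simp_all
qed

lemma modes_cong_AE:
  assumes "f \<in> L2_torus" "g \<in> L2_torus" "AE x in lebesgue_on torus. f x = g x"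
  shows "cos_mode f k = cos_mode g k" "sin_mode f k = sin_mode g k"
  using assms(3) unfolding cos_mode_def sin_mode_def
  by (auto intro!: integral_cong_AE borel_measurable_integrable integrable_cos integrable_sin
      L2_torus_integrable[OF assms(1)] L2_torus_integrable[OF assms(2)])

text \<open>Frequencywise bounds sum up. Summability of the left side is proved first by comparison,
  since \<open>infsum\<close> of a divergent series is zero and would say nothing about the
  norm.\<close>

lemma sobolev_norm_le:
  assumes f: "f \<in> L2_torus" and g: "g \<in> sobolev m" and h: "h \<in> sobolev m" and A: "A \<ge> 0"
    and le: "\<And>k. (1 + (norm (freq k))\<^sup>2) powr s * (norm (fourier_coeff f k))\<^sup>2 \<le>
      A * ((1 + (norm (freq k))\<^sup>2) powr m * (norm (fourier_coeff g k))\<^sup>2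
         + (1 + (norm (freq k))\<^sup>2) powr m * (norm (fourier_coeff h k))\<^sup>2)"
  shows "f \<in> sobolev s" and "sobolev_norm s f \<le> sqrt A * sobolev_pair_norm m g h"
proof -
  let ?F = "\<lambda>k. (1 + (norm (freq k))\<^sup>2) powr s * (norm (fourier_coeff f k))\<^sup>2"
  let ?G = "\<lambda>k. (1 + (norm (freq k))\<^sup>2) powr m * (norm (fourier_coeff g k))\<^sup>2"
  let ?H = "\<lambda>k. (1 + (norm (freq k))\<^sup>2) powr m * (norm (fourier_coeff h k))\<^sup>2"
  have G: "?G summable_on UNIV" and H: "?H summable_on UNIV"
    using g h by (auto simp: sobolev_def)
  have GH: "(\<lambda>k. A * (?G k + ?H k)) summable_on UNIV"
    by (intro summable_on_cmult_right summable_on_add G H)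
  have F: "?F summable_on UNIV"
    by (rule summable_on_comparison_test[OF GH]) (use le in auto)
  then show "f \<in> sobolev s" using f by (simp add: sobolev_def)
  have "infsum ?F UNIV \<le> infsum (\<lambda>k. A * (?G k + ?H k)) UNIV"
    by (rule infsum_mono[OF F GH le])
  also have "\<dots> = A * (infsum ?G UNIV + infsum ?H UNIV)"
    by (simp add: infsum_cmult_right' infsum_add G H)
  finally have "sobolev_norm s f \<le> sqrt (A * (infsum ?G UNIV + infsum ?H UNIV))"
    by (simp add: sobolev_norm_def)
  also have "\<dots> = sqrt A * sobolev_pair_norm m g h"
    by (simp add: sobolev_pair_norm_def sobolev_norm_def real_sqrt_mult infsum_nonneg)
  finally show "sobolev_norm s f \<le> sqrt A * sobolev_pair_norm m g h" .
qed

text \<open>At \<open>k = 0\<close> both \<open>K\<close> and \<open>\<theta>\<close> vanish, so the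
  cosine modes, which are then the plain integrals, keep their initial value zero. The sine modes
  are zero because \<open>sin 0 = 0\<close>.\<close>

lemma zero_mode_vanishes:
  assumes sol: "linear_MHD_solution b U\<^sub>0 B\<^sub>0 U B"
    and L2: "U\<^sub>0 \<in> L2_torus" "B\<^sub>0 \<in> L2_torus"
    and mean: "(LINT x|lebesgue_on torus. U\<^sub>0 x) = 0" "(LINT x|lebesgue_on torus. B\<^sub>0 x) = 0"
    and t: "t \<ge> 0"
  shows "fourier_coeff (U t) 0 = 0" "fourier_coeff (B t) 0 = 0"
proof -
  have sol_L2: "U t \<in> L2_torus" "B t \<in> L2_torus" if "t \<ge> 0" for t
    using sol that by (auto simp: linear_MHD_solution_def)
  have freq0: "freq (0 :: int ^ 'n) = 0" by (simp add: freq_def vec_eq_iff)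
  have AE: "AE x in lebesgue_on torus. U 0 x = U\<^sub>0 x" "AE x in lebesgue_on torus. B 0 x = B\<^sub>0 x"
    using sol by (auto simp: linear_MHD_solution_def elim: eventually_mono)
  have "cos_mode (U 0) 0 = 0" "cos_mode (B 0) 0 = 0"
    using modes_cong_AE(1)[OF sol_L2(1) L2(1) AE(1), of 0]
      modes_cong_AE(1)[OF sol_L2(2) L2(2) AE(2), of 0] mean
    by (simp_all add: cos_mode_def freq0)
  moreover have "cos_mode (U t) 0 = cos_mode (U 0) 0"
    using damped_pair.u_derivative[OF linear_MHD_solution_modes(1)[OF sol, of 0]] t
    by (intro has_derivative_zero_unique[of "{0..}"]) (auto simp: freq0 has_vector_derivative_def)
  moreover have "cos_mode (B t) 0 = cos_mode (B 0) 0"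
    using damped_pair.v_derivative[OF linear_MHD_solution_modes(2)[OF sol, of 0]] t
    by (intro has_derivative_zero_unique[of "{0..}"]) (auto simp: freq0 has_vector_derivative_def)
  ultimately have "(norm (fourier_coeff (U t) 0))\<^sup>2 = 0" "(norm (fourier_coeff (B t) 0))\<^sup>2 = 0"
    by (simp_all add: norm_fourier_coeff sol_L2 t) (simp_all add: sin_mode_def freq0)
  then show "fourier_coeff (U t) 0 = 0" "fourier_coeff (B t) 0 = 0" by simp_all
qed

lemma norm_freq_ge_1:
  fixes k :: "int ^ 'n"
  assumes "k \<noteq> 0"
  shows "(norm (freq k))\<^sup>2 \<ge> 1"
proof -
  obtain i where "k $ i \<noteq> 0" using assms by (auto simp: vec_eq_iff)
  then have "1 \<le> \<bar>real_of_int (k $ i)\<bar>" by (simp flip: of_int_abs)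
  also have "\<dots> \<le> norm (freq k)" using component_le_norm_cart[of "freq k" i] by (simp add: freq_def)
  finally show ?thesis by (simp add: one_le_power)
qed

section \<open>Summation over all frequencies\<close>

theorem theorem1p1:
  fixes b :: "real ^ 'n" and r m :: real
  assumes "CARD('n) \<ge> 2"
    and "r > real CARD('n) - 1"
    and "diophantine r b"
    and "m \<ge> 0"
  shows "\<forall>s\<in>{0..m}. \<exists>C>0. \<forall>U\<^sub>0 B\<^sub>0 U B.
     U\<^sub>0 \<in> sobolev m \<and> B\<^sub>0 \<in> sobolev m \<and>
     div_free U\<^sub>0 \<and> div_free B\<^sub>0 \<and>
     (LINT x|lebesgue_on torus. U\<^sub>0 x) = 0 \<and> (LINT x|lebesgue_on torus. B\<^sub>0 x) = 0 \<and>
     linear_MHD_solution b U\<^sub>0 B\<^sub>0 U B \<longrightarrow>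
     (\<forall>t\<ge>0.
        U t \<in> sobolev s \<and> B t \<in> sobolev s \<and>
        sobolev_norm s (U t)
          \<le> C * (1 + t) powr (- (1 / 2 + (m - s + 1) / (2 * (1 + r)))) * sobolev_pair_norm m U\<^sub>0 B\<^sub>0 \<and>
        sobolev_norm s (B t)
          \<le> C * (1 + t) powr (- ((m - s) / (2 * (1 + r)))) * sobolev_pair_norm m U\<^sub>0 B\<^sub>0)"
proof
  fix s
  assume s: "s \<in> {0..m}"
  have r: "r > - 1" using assms(1,2) by simp
  obtain c where c: "c > 0" "\<And>k::int ^ 'n. k \<noteq> 0 \<Longrightarrow> \<bar>b \<bullet> freq k\<bar> \<ge> c * norm (freq k) powr (- r)"
    using assms(3) by (auto simp: diophantine_def)
  \<comment> \<open>Exponents for the squared norms, twice those of the statement;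
    \<open>root\<close> halves them again.\<close>
  define P where "P = - (1 + (m - s + 1) / (1 + r))"
  define Q where "Q = - ((m - s) / (1 + r))"
  have "b \<bullet> b \<ge> 0" "c\<^sup>2 > 0" "s \<le> m" using c s by auto
  from weighted_mode_decay[where 'a = "real ^ 'n", OF this(1,2) r this(3)] obtain C where C: "C > 0"
    and decay_u: "\<And>(u :: real \<Rightarrow> real ^ 'n) v K \<theta> t. \<lbrakk>damped_pair u v K \<theta>; K \<ge> 1; \<theta>\<^sup>2 \<le> (b \<bullet> b) * K;
       c\<^sup>2 * K powr - r \<le> \<theta>\<^sup>2; t \<ge> 0\<rbrakk> \<Longrightarrow> (1 + K) powr s * (u t \<bullet> u t) \<le>
       C * (1 + t) powr P * ((1 + K) powr m * (u 0 \<bullet> u 0 + v 0 \<bullet> v 0))"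
    and decay_v: "\<And>(u :: real \<Rightarrow> real ^ 'n) v K \<theta> t. \<lbrakk>damped_pair u v K \<theta>; K \<ge> 1; \<theta>\<^sup>2 \<le> (b \<bullet> b) * K;
       c\<^sup>2 * K powr - r \<le> \<theta>\<^sup>2; t \<ge> 0\<rbrakk> \<Longrightarrow> (1 + K) powr s * (v t \<bullet> v t) \<le>
       C * (1 + t) powr Q * ((1 + K) powr m * (u 0 \<bullet> u 0 + v 0 \<bullet> v 0))"
    unfolding P_def Q_def by metis
  have root: "sqrt (C * (1 + t) powr P) = sqrt C * (1 + t) powr (- (1 / 2 + (m - s + 1) / (2 * (1 + r))))"
    "sqrt (C * (1 + t) powr Q) = sqrt C * (1 + t) powr (- ((m - s) / (2 * (1 + r))))"
    if t: "t \<ge> 0" for t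
  proof -
    have "- (1 / 2 + (m - s + 1) / (2 * (1 + r))) = P / 2" "- ((m - s) / (2 * (1 + r))) = Q / 2"
      using r by (simp_all add: P_def Q_def divide_simps) (simp_all add: algebra_simps)
    moreover have "1 + t \<ge> 0" using t by simp
    ultimately show "sqrt (C * (1 + t) powr P) = sqrt C * (1 + t) powr (- (1 / 2 + (m - s + 1) / (2 * (1 + r))))"
      "sqrt (C * (1 + t) powr Q) = sqrt C * (1 + t) powr (- ((m - s) / (2 * (1 + r))))"
      by (simp_all only: real_sqrt_mult powr_half_sqrt_powr)
  qed
  have main: "U t \<in> sobolev s \<and> B t \<in> sobolev s \<and>
        sobolev_norm s (U t) \<le> sqrt (C * (1 + t) powr P) * sobolev_pair_norm m U\<^sub>0 B\<^sub>0 \<and>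
        sobolev_norm s (B t) \<le> sqrt (C * (1 + t) powr Q) * sobolev_pair_norm m U\<^sub>0 B\<^sub>0"
    if U\<^sub>0: "U\<^sub>0 \<in> sobolev m" and B\<^sub>0: "B\<^sub>0 \<in> sobolev m"
      and mean: "(LINT x|lebesgue_on torus. U\<^sub>0 x) = 0" "(LINT x|lebesgue_on torus. B\<^sub>0 x) = 0"
      and sol: "linear_MHD_solution b U\<^sub>0 B\<^sub>0 U B" and t: "t \<ge> 0" for U\<^sub>0 B\<^sub>0 U B t
  proof -
    have L2: "U\<^sub>0 \<in> L2_torus" "B\<^sub>0 \<in> L2_torus" using U\<^sub>0 B\<^sub>0 by (auto simp: sobolev_def)
    have sol_L2: "U t \<in> L2_torus" "B t \<in> L2_torus" if "t \<ge> 0" for t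
      using sol that by (auto simp: linear_MHD_solution_def)
    have AE: "AE x in lebesgue_on torus. U 0 x = U\<^sub>0 x" "AE x in lebesgue_on torus. B 0 x = B\<^sub>0 x"
      using sol by (auto simp: linear_MHD_solution_def elim: eventually_mono)
    note init = modes_cong_AE[OF sol_L2(1) L2(1) AE(1), simplified]
      modes_cong_AE[OF sol_L2(2) L2(2) AE(2), simplified]
    let ?W = "\<lambda>k :: int ^ 'n. 1 + (norm (freq k))\<^sup>2"
    have bound: "?W k powr s * (norm (fourier_coeff (U t) k))\<^sup>2 \<le> C * (1 + t) powr P *
          (?W k powr m * (norm (fourier_coeff U\<^sub>0 k))\<^sup>2 + ?W k powr m * (norm (fourier_coeff B\<^sub>0 k))\<^sup>2) \<and>
        ?W k powr s * (norm (fourier_coeff (B t) k))\<^sup>2 \<le> C * (1 + t) powr Q *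
          (?W k powr m * (norm (fourier_coeff U\<^sub>0 k))\<^sup>2 + ?W k powr m * (norm (fourier_coeff B\<^sub>0 k))\<^sup>2)"
      for k
    proof (cases "k = 0")
      case True
      then show ?thesis using zero_mode_vanishes[OF sol L2 mean t] C by simp
    next
      case False
      let ?K = "(norm (freq k))\<^sup>2" and ?\<theta> = "b \<bullet> freq k"
      have K: "?K \<ge> 1" using norm_freq_ge_1[OF False] .
      have \<theta>: "?\<theta>\<^sup>2 \<le> (b \<bullet> b) * ?K" "(- ?\<theta>)\<^sup>2 \<le> (b \<bullet> b) * ?K"
        using Cauchy_Schwarz_ineq[of b "freq k"] by (simp_all add: power2_norm_eq_inner)
      \<comment> \<open>The squared Diophantine bound in terms of \<open>?K\<close>, which is why
        the mode estimate is used with \<open>c\<^sup>2\<close>.\<close>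
      have "c\<^sup>2 * ?K powr - r = (c * norm (freq k) powr - r)\<^sup>2"
        using K by (simp add: power_mult_distrib powr_power powr_powr mult.commute flip: powr_numeral)
      also have "\<dots> \<le> \<bar>?\<theta>\<bar>\<^sup>2" using c False by (intro power_mono) auto
      finally have dio: "c\<^sup>2 * ?K powr - r \<le> ?\<theta>\<^sup>2" "c\<^sup>2 * ?K powr - r \<le> (- ?\<theta>)\<^sup>2" by simp_all
      note pair = linear_MHD_solution_modes[OF sol, of k]
      \<comment> \<open>Adds the bounds for the two pairs at frequency \<open>k\<close>. Their
        initial energies \<open>a\<close> and \<open>a'\<close> sum to the full mode energies
        \<open>e\<close> of \<open>U\<^sub>0\<close> and \<open>e'\<close> of
        \<open>B\<^sub>0\<close>; \<open>N\<close> is the Fourier normalisation.\<close>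
      have scale: "w * ((x + y) / N) \<le> D * (z * (e / N) + z * (e' / N))"
        if "w * x \<le> D * (z * a)" "w * y \<le> D * (z * a')" "a + a' = e + e'" "N > 0"
        for w x y N D z a a' e e' :: real
      proof -
        have "w * x + w * y \<le> D * (z * (a + a'))" using that(1,2) by (simp add: distrib_left)
        then have "(w * x + w * y) / N \<le> D * (z * (e + e')) / N"
          using that(3,4) by (intro divide_right_mono) simp_all
        then show ?thesis by (simp add: distrib_left add_divide_distrib)
      qed
      have N: "((2 * pi) ^ CARD('n))\<^sup>2 > 0" by simp
      show ?thesis
        unfolding norm_fourier_coeff[OF sol_L2(1)[OF t]] norm_fourier_coeff[OF sol_L2(2)[OF t]]
          norm_fourier_coeff[OF L2(1)] norm_fourier_coeff[OF L2(2)]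
        by (intro conjI
            scale[OF decay_u[OF pair(1) K \<theta>(1) dio(1) t] decay_u[OF pair(2) K \<theta>(2) dio(2) t] _ N]
            scale[OF decay_v[OF pair(2) K \<theta>(2) dio(2) t] decay_v[OF pair(1) K \<theta>(1) dio(1) t] _ N])
          (simp_all add: init)
    qed
    then show ?thesis
      using sobolev_norm_le[OF sol_L2(1)[OF t] U\<^sub>0 B\<^sub>0, of "C * (1 + t) powr P" s]
        sobolev_norm_le[OF sol_L2(2)[OF t] U\<^sub>0 B\<^sub>0, of "C * (1 + t) powr Q" s] C by simp
  qed
  show "\<exists>C>0. \<forall>U\<^sub>0 B\<^sub>0 U B.
     U\<^sub>0 \<in> sobolev m \<and> B\<^sub>0 \<in> sobolev m \<and>
     div_free U\<^sub>0 \<and> div_free B\<^sub>0 \<and>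
     (LINT x|lebesgue_on torus. U\<^sub>0 x) = 0 \<and> (LINT x|lebesgue_on torus. B\<^sub>0 x) = 0 \<and>
     linear_MHD_solution b U\<^sub>0 B\<^sub>0 U B \<longrightarrow>
     (\<forall>t\<ge>0.
        U t \<in> sobolev s \<and> B t \<in> sobolev s \<and>
        sobolev_norm s (U t)
          \<le> C * (1 + t) powr (- (1 / 2 + (m - s + 1) / (2 * (1 + r)))) * sobolev_pair_norm m U\<^sub>0 B\<^sub>0 \<and>
        sobolev_norm s (B t)
          \<le> C * (1 + t) powr (- ((m - s) / (2 * (1 + r)))) * sobolev_pair_norm m U\<^sub>0 B\<^sub>0)"
    using main C root by (intro exI[of _ "sqrt C"]) auto
qed

end
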